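(* Let $n\in\mathbb{N}$, let $T=\mathrm{conv}\{v_1,v_2,v_3\}\subset\mathbb{R}^2$ be a non-degenerate triangle, let $N=\binom{n+2}{2}$, let $\mathbf{x}_1,\dots,\mathbf{x}_N\in T$ be distinct interpolation nodes satisfying the Solvability Condition (S) with lines $\gamma_0,\dots,\gamma_n$ and node sets $\mathcal{A}_0,\dots,\mathcal{A}_n$ (see context), and let $f_1,\dots,f_N\in\mathbb{R}$ be given data. For $k=0,\dots,n$ let $\Gamma_k$ be an affine polynomial (polynomial of degree at most one) such that $\mathbf{x}\in\gamma_k$ if and only if $\Gamma_k(\mathbf{x})=0$. For $j=n,n-1,\dots,0$ successively, let $q_j\in\mathbb{P}^j(T)$ be a (not necessarily unique) polynomial satisfying $$q_j(\mathbf{x}_i)=\frac{f_i-\sum_{k=j+1}^{n}q_k(\mathbf{x}_i)\prod_{l=k+1}^{n}\Gamma_l(\mathbf{x}_i)}{\prod_{l=j+1}^{n}\Gamma_l(\mathbf{x}_i)}\qquad\text{for all }\mathbf{x}_i\in\mathcal{A}_j.$$ Define $$p(\mathbf{x})=\sum_{j=0}^{n}q_j(\mathbf{x})\prod_{i=j+1}^{n}\Gamma_i(\mathbf{x}),\qquad \mathbf{x}\in T.$$ Then $p$ belongs to $\mathbb{P}^n(T)$ and solves the interpolation problem: $p(\mathbf{x}_i)=f_i$ for $i=1,\dots,N$.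
   Context: $\mathbb{P}^j(T)$ denotes the space of polynomials on $T$ of total degree at most $j$. Empty products equal $1$ and empty sums equal $0$. Solvability Condition (S): there exist distinct lines $\gamma_0,\gamma_1,\dots,\gamma_n$ in $\mathbb{R}^2$ such that the set of interpolation nodes can be partitioned into non-overlapping sets $\mathcal{A}_n,\mathcal{A}_{n-1},\dots,\mathcal{A}_0$, where $\mathcal{A}_j$ contains exactly $j+1$ nodes, all located on $\gamma_j\setminus(\gamma_{j+1}\cup\dots\cup\gamma_n)$. Under Condition (S) the denominators above are nonzero, and each condition on $q_j$ is a univariate interpolation problem with $j+1$ distinct nodes on the line $\gamma_j$, so polynomials $q_j$ as described exist; they are in general not unique, since only the values on $\gamma_j$ are determined. *)

theory Defs
  imports "HOL-Analysis.Analysis"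
begin

text \<open>
  The polynomials of total degree at most \<open>j\<close> on \<open>T\<close>. Members are total functions whose values
  outside \<open>T\<close> are unconstrained; taking \<open>T = UNIV\<close> gives polynomials on the whole plane.
\<close>
definition poly_space :: "nat \<Rightarrow> (real^2) set \<Rightarrow> (real^2 \<Rightarrow> real) set" where
  "poly_space j T =
     {f. \<exists>c :: nat \<Rightarrow> nat \<Rightarrow> real. \<forall>x\<in>T. f x = (\<Sum>a\<le>j. \<Sum>b\<le>j - a. c a b * (x$1)^a * (x$2)^b)}"

definition is_line :: "(real^2) set \<Rightarrow> bool" where
  "is_line L \<longleftrightarrow> affine L \<and> aff_dim L = 1"

text \<open>
  Condition (S) for the node set \<open>X\<close>, with the lines \<open>\<gamma> 0, \<dots>, \<gamma> n\<close> and the node sets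
  \<open>A 0, \<dots>, A n\<close> as explicit witnesses.
\<close>
definition solvability_condition ::
    "nat \<Rightarrow> (real^2) set \<Rightarrow> (nat \<Rightarrow> (real^2) set) \<Rightarrow> (nat \<Rightarrow> (real^2) set) \<Rightarrow> bool" where
  "solvability_condition n X \<gamma> A \<longleftrightarrow>
     (\<forall>j\<le>n. is_line (\<gamma> j)) \<and> inj_on \<gamma> {..n} \<and>
     (\<Union>j\<le>n. A j) = X \<and> disjoint_family_on A {..n} \<and>
     (\<forall>j\<le>n. card (A j) = j + 1 \<and> A j \<subseteq> \<gamma> j - (\<Union>k\<in>{j+1..n}. \<gamma> k))"

end

theory Submission
  imports Defs
begin

text \<open>
  At a node of \<open>A j\<close> every summand with index below \<open>j\<close> contains the factor \<open>\<Gamma> j\<close>, which vanishes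
  on \<open>\<gamma> j\<close>; the summands with index above \<open>j\<close> are compensated by the choice of \<open>q j\<close>. The division
  is legitimate because the node avoids the later lines. The degree bound is \<open>j + (n - j) = n\<close>.
\<close>

lemma poly_space_add:
  assumes "f \<in> poly_space j T" "g \<in> poly_space j T"
  shows "(\<lambda>x. f x + g x) \<in> poly_space j T"
proof -
  obtain c d where
    "\<forall>x\<in>T. f x = (\<Sum>a\<le>j. \<Sum>b\<le>j - a. c a b * (x$1)^a * (x$2)^b)"
    "\<forall>x\<in>T. g x = (\<Sum>a\<le>j. \<Sum>b\<le>j - a. d a b * (x$1)^a * (x$2)^b)"
    using assms unfolding poly_space_def by blast
  then show ?thesis
    unfolding poly_space_def
    by (auto intro!: exI[of _ "\<lambda>a b. c a b + d a b"] simp: sum.distrib distrib_right)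
qed

lemma poly_space_cmult:
  assumes "f \<in> poly_space j T"
  shows "(\<lambda>x. r * f x) \<in> poly_space j T"
proof -
  obtain c where "\<forall>x\<in>T. f x = (\<Sum>a\<le>j. \<Sum>b\<le>j - a. c a b * (x$1)^a * (x$2)^b)"
    using assms unfolding poly_space_def by blast
  then show ?thesis
    unfolding poly_space_def
    by (auto intro!: exI[of _ "\<lambda>a b. r * c a b"] simp: sum_distrib_left mult.assoc)
qed

lemma poly_space_zero: "(\<lambda>x. 0) \<in> poly_space j T"
  unfolding poly_space_def by (auto intro!: exI[of _ "\<lambda>a b. 0"])

lemma poly_space_sum:
  assumes "\<And>i. i \<in> I \<Longrightarrow> f i \<in> poly_space j T"
  shows "(\<lambda>x. \<Sum>i\<in>I. f i x) \<in> poly_space j T"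
  using assms
  by (induction I rule: infinite_finite_induct) (auto intro: poly_space_zero poly_space_add)

text \<open>Membership constrains values on \<open>T\<close> only, so a function may be exchanged
  for any expression agreeing with it there. This matters for \<open>p\<close>, whose formula is
  given on \<open>T\<close> alone.\<close>

lemma poly_space_cong:
  assumes "\<And>x. x \<in> T \<Longrightarrow> f x = g x"
  shows "f \<in> poly_space j T \<longleftrightarrow> g \<in> poly_space j T"
  using assms unfolding poly_space_def by simp

text \<open>The same coefficients serve on the smaller set. This brings the factors
  \<open>\<Gamma> k\<close>, polynomial on the whole plane, into the space over \<open>T\<close>
  where the \<open>q j\<close> live.\<close>

lemma poly_space_subset: "S \<subseteq> T \<Longrightarrow> poly_space j T \<subseteq> poly_space j S"
  unfolding poly_space_def by blast

text \<open>The coefficients are the indicator of the index pair \<open>(a, b)\<close>. The bound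
  \<open>a + b \<le> j\<close> places this pair in the triangular index range, so exactly one term
  of the double sum survives.\<close>

lemma monomial_in_poly_space:
  assumes "a + b \<le> j"
  shows "(\<lambda>x. (x$1)^a * (x$2)^b) \<in> poly_space j T"
proof -
  have "(\<Sum>a'\<le>j. \<Sum>b'\<le>j - a'. (if a' = a then if b' = b then 1 else 0 else 0) * (x$1)^a' * (x$2)^b')
      = (x$1)^a * (x$2)^b" for x :: "real^2"
  proof -
    have "(\<Sum>b'\<le>j - a'. (if a' = a then if b' = b then 1 else 0 else 0) * (x$1)^a' * (x$2)^b')
        = (if a' = a then (x$1)^a * (x$2)^b else 0)" for a'
    proof (cases "a' = a")
      case True
      have "(\<Sum>b'\<le>j - a. (if b' = b then 1 else 0) * (x$1)^a * (x$2)^b')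
          = (\<Sum>b'\<le>j - a. if b' = b then (x$1)^a * (x$2)^b else 0)"
        by (rule sum.cong) auto
      with True assms show ?thesis by simp
    qed simp
    with assms show ?thesis by simp
  qed
  then show ?thesis
    unfolding poly_space_def
    by (auto intro!: exI[of _ "\<lambda>a' b'. if a' = a then if b' = b then 1 else 0 else 0"])
qed

text \<open>Expanding both factors gives a finite linear combination of monomials, each of degree at
  most \<open>j + k\<close>. Closure under sums and scalar multiples then suffices, and no
  convolution of the coefficients has to be written down.\<close>

lemma poly_space_mult:
  assumes "f \<in> poly_space j T" "g \<in> poly_space k T"
  shows "(\<lambda>x. f x * g x) \<in> poly_space (j + k) T"
proof -
  obtain c d where
    f: "\<And>x. x \<in> T \<Longrightarrow> f x = (\<Sum>a\<le>j. \<Sum>b\<le>j - a. c a b * (x$1)^a * (x$2)^b)" and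
    g: "\<And>x. x \<in> T \<Longrightarrow> g x = (\<Sum>a\<le>k. \<Sum>b\<le>k - a. d a b * (x$1)^a * (x$2)^b)"
    using assms unfolding poly_space_def by blast
  have "f x * g x = (\<Sum>a\<le>j. \<Sum>b\<le>j - a. \<Sum>a'\<le>k. \<Sum>b'\<le>k - a'.
      (c a b * d a' b') * ((x$1)^(a + a') * (x$2)^(b + b')))" if "x \<in> T" for x
    unfolding f[OF that] g[OF that] sum_distrib_right
    by (simp add: sum_distrib_left power_add mult_ac)
  then show ?thesis
    by (subst poly_space_cong, assumption)
      (intro poly_space_sum poly_space_cmult monomial_in_poly_space, auto)
qed

text \<open>Each factor of degree at most one raises the degree bound by one, starting from the
  constant monomial for the empty product.\<close>

lemma poly_space_prod:
  assumes "finite I" "\<And>i. i \<in> I \<Longrightarrow> f i \<in> poly_space 1 T"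
  shows "(\<lambda>x. \<Prod>i\<in>I. f i x) \<in> poly_space (card I) T"
  using assms
proof (induction I)
  case empty
  show ?case using monomial_in_poly_space[of 0 0 0 T] by simp
next
  case (insert i I)
  with poly_space_mult[of "f i" 1 T "\<lambda>x. \<Prod>i\<in>I. f i x" "card I"] show ?case by simp
qed

theorem theorem4p2:
  fixes n N :: nat
    and v1 v2 v3 :: "real^2"
    and T :: "(real^2) set"
    and x :: "nat \<Rightarrow> real^2"
    and f :: "nat \<Rightarrow> real"
    and \<gamma> A :: "nat \<Rightarrow> (real^2) set"
    and \<Gamma> q :: "nat \<Rightarrow> real^2 \<Rightarrow> real"
    and p :: "real^2 \<Rightarrow> real"
  assumes "T = convex hull {v1, v2, v3}"
    and "\<not> collinear {v1, v2, v3}"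
    and "N = (n + 2) choose 2"
    and "\<forall>i\<in>{1..N}. x i \<in> T"
    and "inj_on x {1..N}"
    and "solvability_condition n (x ` {1..N}) \<gamma> A"
    and "\<forall>k\<le>n. \<Gamma> k \<in> poly_space 1 UNIV \<and> (\<forall>y. y \<in> \<gamma> k \<longleftrightarrow> \<Gamma> k y = 0)"
    and "\<forall>j\<le>n. q j \<in> poly_space j T"
    and "\<forall>j\<le>n. \<forall>i\<in>{1..N}. x i \<in> A j \<longrightarrow>
           q j (x i) =
             (f i - (\<Sum>k=j+1..n. q k (x i) * (\<Prod>l=k+1..n. \<Gamma> l (x i)))) / (\<Prod>l=j+1..n. \<Gamma> l (x i))"
    and "\<forall>y\<in>T. p y = (\<Sum>j=0..n. q j y * (\<Prod>i=j+1..n. \<Gamma> i y))"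
  shows "p \<in> poly_space n T \<and> (\<forall>i\<in>{1..N}. p (x i) = f i)"
proof
  have summand: "(\<lambda>y. q j y * (\<Prod>i=j+1..n. \<Gamma> i y)) \<in> poly_space n T" if "j \<le> n" for j
  proof -
    have "(\<lambda>y. \<Prod>i=j+1..n. \<Gamma> i y) \<in> poly_space (card {j+1..n}) T"
      using assms(7) poly_space_subset[of T UNIV 1] by (intro poly_space_prod) auto
    with that poly_space_mult[of "q j" j T] assms(8) show ?thesis by fastforce
  qed
  have "(\<lambda>y. \<Sum>j=0..n. q j y * (\<Prod>i=j+1..n. \<Gamma> i y)) \<in> poly_space n T"
    by (intro poly_space_sum summand) simp
  then show "p \<in> poly_space n T"
    using assms(10) by (subst poly_space_cong) auto
  show "\<forall>i\<in>{1..N}. p (x i) = f i"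
  proof
    fix i assume i: "i \<in> {1..N}"
    then obtain j where j: "j \<le> n" "x i \<in> A j"
      using assms(6) unfolding solvability_condition_def by blast
    then have on: "x i \<in> \<gamma> j" and off: "\<And>l. l \<in> {j+1..n} \<Longrightarrow> x i \<notin> \<gamma> l"
      using assms(6) unfolding solvability_condition_def by blast+
    let ?g = "\<lambda>k. q k (x i) * (\<Prod>l=k+1..n. \<Gamma> l (x i))"
    have "\<Gamma> j (x i) = 0"
      using on j(1) assms(7) by blast
    \<comment> \<open>The product in \<open>?g k\<close> starts at \<open>k + 1\<close>, so
      \<open>k < j\<close> and \<open>j \<le> n\<close> put the vanishing factor of index
      \<open>j\<close> in its range.\<close>
    then have below: "?g k = 0" if "k < j" for k
      using that j(1) by (auto intro!: prod_zero bexI[of _ j])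
    have "\<Gamma> l (x i) \<noteq> 0" if "l \<in> {j+1..n}" for l
      using that off assms(7) by auto
    then have "(\<Prod>l=j+1..n. \<Gamma> l (x i)) \<noteq> 0"
      by simp
    \<comment> \<open>The denominator in the condition on \<open>q j\<close> is exactly the product
      in \<open>?g j\<close>; as it is nonzero, multiplying by it clears the fraction.\<close>
    then have at: "?g j = f i - (\<Sum>k=j+1..n. ?g k)"
      using assms(9) i j by simp
    \<comment> \<open>The formula for \<open>p\<close> applies because the node lies in
      \<open>T\<close>.\<close>
    have "p (x i) = (\<Sum>k=0..n. ?g k)"
      using assms(4,10) i by blast
    also have "\<dots> = (\<Sum>k=j..n. ?g k)"
      by (intro sum.mono_neutral_right ballI below) auto
    also have "\<dots> = ?g j + (\<Sum>k=j+1..n. ?g k)"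
      using j(1) by (simp add: sum.atLeast_Suc_atMost)
    finally show "p (x i) = f i"
      using at by simp
  qed
qed

end
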